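(* Let $\Gamma$ be an infinite cardinal with $\Gamma^\omega=\Gamma$, and let $\mathcal{D}$ be a $(\sqrt{2}+)$-separated and $1$-dense subgroup of $\ell_2(\Gamma)$, with associated Voronoi cells $\{V_d\}_{d\in\mathcal{D}}$. Let $|||\cdot|||$ be the equivalent norm on $\ell_2(\Gamma)$ whose closed unit ball is $V_0$. Then the tiling $\{V_d\}_{d\in\mathcal{D}}$ of $\ell_2(\Gamma)$ is point-countable. Therefore, $(\ell_2(\Gamma),|||\cdot|||)$ admits a point-countable (lattice) tiling with balls of radius $1$. Further, the collection $\{d+B_{\ell_2(\Gamma)}\}_{d\in\mathcal{D}}$ constitutes a point-countable covering of $\ell_2(\Gamma)$ by balls of unit radius in the canonical norm.
   Context: All spaces are over the real field. $\Gamma^\omega$ denotes cardinal exponentiation. $B_{\ell_2(\Gamma)}$ is the closed unit ball of $\ell_2(\Gamma)$ in the canonical norm $\|\cdot\|_2$. A subset $\mathcal{D}$ of a normed space $\mathcal{X}$ is $(r+)$-separated if $\|d-h\|>r$ for all distinct $d,h\in\mathcal{D}$, and $r$-dense if for every $x\in\mathcal{X}$ there is $d\in\mathcal{D}$ with $\|x-d\|\leq r$. A subgroup $\mathcal{D}$ as in the claim exists when $\Gamma^\omega=\Gamma$. The Voronoi cells associated to $\mathcal{D}\subseteq\ell_2(\Gamma)$ are $V_d=\{x\in\ell_2(\Gamma)\colon \|x-d\|_2\leq\|x-h\|_2 \text{ for all } h\in\mathcal{D}\}$, $d\in\mathcal{D}$. For $\mathcal{D}$ as in the claim, $V_d=d+V_0$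 for each $d\in\mathcal{D}$, $V_0$ is a symmetric convex body with $\frac{\sqrt2}{2}B_{\ell_2(\Gamma)}\subseteq V_0\subseteq B_{\ell_2(\Gamma)}$ (so $V_0$ is the closed unit ball of an equivalent norm), and $\{V_d\}_{d\in\mathcal{D}}$ is a tiling of $\ell_2(\Gamma)$. A body is a set that is the closure of its non-empty interior; a tiling of a normed space is a family of bodies that covers the space and whose members have mutually disjoint interiors. A tiling is a lattice tiling if it has the form $\{d+B\colon d\in\mathcal{D}\}$ for a body $B$ and a (discrete) subgroup $\mathcal{D}$. A family of subsets of $\mathcal{X}$ is point-countable if each $x\in\mathcal{X}$ belongs to at most countably many members of the family. *)

theory Defs
  imports "HOL-Analysis.Analysis"
begin

unbundle cardinal_syntax

section \<open>The real Hilbert space of square-summable families\<close>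

text \<open>The index set is the universe of a type; its cardinality plays the role of
  \<open>\<Gamma>\<close>.\<close>

typedef 'a ell2 = "{f :: 'a \<Rightarrow> real. (\<lambda>i. (f i)\<^sup>2) summable_on UNIV}"
  morphisms ell2_nth Abs_ell2
  by (rule exI[of _ "\<lambda>_. 0"]) simp

setup_lifting type_definition_ell2

lemma square_summable_mult:
  fixes f g :: "'a \<Rightarrow> real"
  assumes "(\<lambda>i. (f i)\<^sup>2) summable_on UNIV" "(\<lambda>i. (g i)\<^sup>2) summable_on UNIV"
  shows "(\<lambda>i. f i * g i) summable_on UNIV"
proof -
  have "(\<lambda>i. (f i)\<^sup>2 + (g i)\<^sup>2) summable_on UNIV"
    using assms by (rule summable_on_add)
  moreover have "norm (f i * g i) \<le> (f i)\<^sup>2 + (g i)\<^sup>2" for i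
  proof -
    have "2 * (\<bar>f i\<bar> * \<bar>g i\<bar>) \<le> (f i)\<^sup>2 + (g i)\<^sup>2"
      using sum_squares_bound[of "\<bar>f i\<bar>" "\<bar>g i\<bar>"] by (simp add: mult.assoc)
    moreover have "0 \<le> \<bar>f i\<bar> * \<bar>g i\<bar>" by simp
    ultimately show ?thesis unfolding real_norm_def abs_mult by linarith
  qed
  ultimately have "(\<lambda>i. norm (f i * g i)) summable_on UNIV"
    by (rule summable_on_comparison_test) simp
  then show ?thesis by (rule abs_summable_summable)
qed

lemma square_summable_add:
  fixes f g :: "'a \<Rightarrow> real"
  assumes "(\<lambda>i. (f i)\<^sup>2) summable_on UNIV" "(\<lambda>i. (g i)\<^sup>2) summable_on UNIV"
  shows "(\<lambda>i. (f i + g i)\<^sup>2) summable_on UNIV"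
proof -
  have "(\<lambda>i. (f i)\<^sup>2 + (g i)\<^sup>2 + 2 * (f i * g i)) summable_on UNIV"
    by (rule summable_on_add[OF summable_on_add[OF assms]
          summable_on_cmult_right[OF square_summable_mult[OF assms]]])
  then show ?thesis by (simp add: power2_sum mult.assoc)
qed

lemma square_summable_scale:
  fixes f :: "'a \<Rightarrow> real"
  assumes "(\<lambda>i. (f i)\<^sup>2) summable_on UNIV"
  shows "(\<lambda>i. (c * f i)\<^sup>2) summable_on UNIV"
  unfolding power_mult_distrib by (rule summable_on_cmult_right[OF assms])

instantiation ell2 :: (type) real_vector
begin

lift_definition zero_ell2 :: "'a ell2" is "\<lambda>_. 0" by simp
lift_definition plus_ell2 :: "'a ell2 \<Rightarrow> 'a ell2 \<Rightarrow> 'a ell2" is "\<lambda>f g i. f i + g i"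
  by (rule square_summable_add)
lift_definition uminus_ell2 :: "'a ell2 \<Rightarrow> 'a ell2" is "\<lambda>f i. - f i" by simp
lift_definition minus_ell2 :: "'a ell2 \<Rightarrow> 'a ell2 \<Rightarrow> 'a ell2" is "\<lambda>f g i. f i - g i"
  subgoal for f g using square_summable_add[of f "\<lambda>i. - g i"] by simp
  done
lift_definition scaleR_ell2 :: "real \<Rightarrow> 'a ell2 \<Rightarrow> 'a ell2" is "\<lambda>c f i. c * f i"
  by (rule square_summable_scale)

instance
proof
  fix x y z :: "'a ell2" and a b :: real
  show "x + y + z = x + (y + z)" by transfer (simp add: add.assoc)
  show "x + y = y + x" by transfer (simp add: add.commute)
  show "0 + x = x" by transfer simp
  show "- x + x = 0" by transfer simp
  show "x - y = x + - y" by transfer simp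
  show "a *\<^sub>R (x + y) = a *\<^sub>R x + a *\<^sub>R y" by transfer (simp add: distrib_left)
  show "(a + b) *\<^sub>R x = a *\<^sub>R x + b *\<^sub>R x" by transfer (simp add: distrib_right)
  show "a *\<^sub>R b *\<^sub>R x = (a * b) *\<^sub>R x" by transfer (simp add: mult.assoc)
  show "1 *\<^sub>R x = x" by transfer simp
qed

end

instantiation ell2 :: (type) real_inner
begin

lift_definition inner_ell2 :: "'a ell2 \<Rightarrow> 'a ell2 \<Rightarrow> real" is
  "\<lambda>f g. \<Sum>\<^sub>\<infinity>i. f i * g i" .
lift_definition norm_ell2 :: "'a ell2 \<Rightarrow> real" is "\<lambda>f. sqrt (\<Sum>\<^sub>\<infinity>i. (f i)\<^sup>2)" .
definition "sgn_ell2 (x :: 'a ell2) = x /\<^sub>R norm x"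
definition "dist_ell2 (x :: 'a ell2) y = norm (x - y)"
definition "(uniformity :: ('a ell2 \<times> 'a ell2) filter)
  = (INF e\<in>{0<..}. principal {(x, y). dist x y < e})"
definition "open_ell2 (U :: 'a ell2 set)
  \<longleftrightarrow> (\<forall>x\<in>U. \<forall>\<^sub>F (x', y) in uniformity. x' = x \<longrightarrow> y \<in> U)"

instance
proof
  fix x y z :: "'a ell2" and r :: real
  show "inner x y = inner y x" by transfer (simp add: mult.commute)
  show "inner (x + y) z = inner x z + inner y z"
    by transfer (simp add: distrib_right infsum_add square_summable_mult)
  show "inner (r *\<^sub>R x) y = r * inner x y"
    by transfer (simp add: mult.assoc infsum_cmult_right')
  show "0 \<le> inner x x" by transfer (simp add: infsum_nonneg)
  show "inner x x = 0 \<longleftrightarrow> x = 0"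
  proof transfer
    fix f :: "'a \<Rightarrow> real"
    assume "(\<lambda>i. (f i)\<^sup>2) summable_on UNIV"
    then have s: "(\<lambda>i. f i * f i) summable_on UNIV" by (simp add: power2_eq_square)
    show "(\<Sum>\<^sub>\<infinity>i. f i * f i) = 0 \<longleftrightarrow> f = (\<lambda>_. 0)"
    proof
      assume "(\<Sum>\<^sub>\<infinity>i. f i * f i) = 0"
      then have "f i * f i = 0" for i
        using nonneg_infsum_le_0D[OF _ s, of i] by simp
      then show "f = (\<lambda>_. 0)" by auto
    qed simp
  qed
  show "norm x = sqrt (inner x x)" by transfer (simp add: power2_eq_square)
qed (rule sgn_ell2_def dist_ell2_def uniformity_ell2_def open_ell2_def)+

end


section \<open>Separated and dense subgroups, Voronoi cells\<close>

definition add_subgroup :: "'a::ab_group_add set \<Rightarrow> bool" where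
  "add_subgroup D \<longleftrightarrow> 0 \<in> D \<and> (\<forall>x\<in>D. \<forall>y\<in>D. x + y \<in> D) \<and> (\<forall>x\<in>D. - x \<in> D)"

definition plus_separated :: "real \<Rightarrow> 'a::real_normed_vector set \<Rightarrow> bool" where
  "plus_separated r D \<longleftrightarrow> (\<forall>d\<in>D. \<forall>h\<in>D. d \<noteq> h \<longrightarrow> norm (d - h) > r)"

definition r_dense :: "real \<Rightarrow> 'a::real_normed_vector set \<Rightarrow> bool" where
  "r_dense r D \<longleftrightarrow> (\<forall>x. \<exists>d\<in>D. norm (x - d) \<le> r)"

definition voronoi_cell :: "'a::real_normed_vector set \<Rightarrow> 'a \<Rightarrow> 'a set" where
  "voronoi_cell D d = {x. \<forall>h\<in>D. norm (x - d) \<le> norm (x - h)}"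


section \<open>Equivalent norms\<close>

definition equivalent_norm :: "('a::real_normed_vector \<Rightarrow> real) \<Rightarrow> bool" where
  "equivalent_norm N \<longleftrightarrow>
     (\<forall>x. N x = 0 \<longleftrightarrow> x = 0) \<and>
     (\<forall>c x. N (c *\<^sub>R x) = \<bar>c\<bar> * N x) \<and>
     (\<forall>x y. N (x + y) \<le> N x + N y) \<and>
     (\<exists>a>0. \<exists>b>0. \<forall>x. a * norm x \<le> N x \<and> N x \<le> b * norm x)"

definition norm_cball :: "('a::real_vector \<Rightarrow> real) \<Rightarrow> 'a \<Rightarrow> real \<Rightarrow> 'a set" where
  "norm_cball N c r = {x. N (x - c) \<le> r}"

definition norm_topology :: "('a::real_vector \<Rightarrow> real) \<Rightarrow> 'a topology" where
  "norm_topology N = Metric_space.mtopology UNIV (\<lambda>x y. N (x - y))"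


section \<open>Tilings\<close>

text \<open>Families are indexed: \<open>F\<close> restricted to the index set \<open>I\<close>.  The topology is a
  parameter, so that the notions apply to the same vector space under different norms.\<close>

definition is_body :: "'a topology \<Rightarrow> 'a set \<Rightarrow> bool" where
  "is_body X S \<longleftrightarrow> X interior_of S \<noteq> {} \<and> S = X closure_of (X interior_of S)"

definition is_tiling :: "'a topology \<Rightarrow> 'i set \<Rightarrow> ('i \<Rightarrow> 'a set) \<Rightarrow> bool" where
  "is_tiling X I F \<longleftrightarrow>
     (\<forall>i\<in>I. is_body X (F i)) \<and>
     (\<Union>i\<in>I. F i) = topspace X \<and>
     (\<forall>i\<in>I. \<forall>j\<in>I. i \<noteq> j \<longrightarrow> X interior_of F i \<inter> X interior_of F j = {})"

definition is_lattice_tiling ::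
    "'a::ab_group_add topology \<Rightarrow> 'i set \<Rightarrow> ('i \<Rightarrow> 'a set) \<Rightarrow> bool" where
  "is_lattice_tiling X I F \<longleftrightarrow> is_tiling X I F \<and>
     (\<exists>B D. is_body X B \<and> add_subgroup D \<and> subtopology X D = discrete_topology D \<and>
       F ` I = (\<lambda>d. (+) d ` B) ` D)"

definition point_countable :: "'i set \<Rightarrow> ('i \<Rightarrow> 'a set) \<Rightarrow> bool" where
  "point_countable I F \<longleftrightarrow> (\<forall>x. countable {i \<in> I. x \<in> F i})"

end

theory Submission
  imports Defs
begin

text \<open>Translating by \<open>- x\<close>, the points of \<open>D\<close> in the unit ball about \<open>x\<close> become vectors of norm at
  most 1 whose mutual distances exceed \<open>sqrt 2\<close>, so their pairwise inner products are negative.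
  For such a family, the norm of a sum of \<open>n\<close> members is at most \<open>sqrt n\<close>; testing the sum
  against a fixed member \<open>w\<close> shows that only finitely many members \<open>u\<close> satisfy
  \<open>w \<bullet> u \<le> - e\<close>, for each \<open>e > 0\<close>, and hence that the family is countable. The same estimate makes
  the family finite in balls of radius less than 1, so nearest points in \<open>D\<close> exist.
  The gauge of \<open>V\<^sub>0\<close> is the supremum of the functionals \<open>2 (x \<bullet> h) / |h|\<^sup>2\<close> for \<open>h \<in> D\<close>.\<close>

section \<open>Vectors with negative inner products\<close>

text \<open>Expanding the squared norm of the sum, the cross terms are at most 0 and each vector
  contributes at most 1 on the diagonal.\<close>

lemma norm_sum_le_of_nonpos_inner:
  fixes F :: "'a::real_inner set"
  assumes "finite F" and "\<And>u. u \<in> F \<Longrightarrow> norm u \<le> 1"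
    and "\<And>u v. u \<in> F \<Longrightarrow> v \<in> F \<Longrightarrow> u \<noteq> v \<Longrightarrow> u \<bullet> v \<le> 0"
  shows "(norm (\<Sum>F))\<^sup>2 \<le> card F"
  using assms
proof (induction F rule: finite_induct)
  case (insert w F)
  have "w \<bullet> \<Sum>F \<le> 0"
    unfolding inner_sum_right
  proof (rule sum_nonpos)
    fix u assume "u \<in> F"
    then show "w \<bullet> u \<le> 0" using insert.hyps(2) insert.prems(2)[of w u] by auto
  qed
  moreover have "(norm w)\<^sup>2 \<le> 1"
    using insert.prems(1)[of w] by (simp add: abs_square_le_1)
  moreover have "(norm (\<Sum>F))\<^sup>2 \<le> card F"
    using insert by auto
  moreover have "(norm (w + \<Sum>F))\<^sup>2 = (norm w)\<^sup>2 + (norm (\<Sum>F))\<^sup>2 + 2 * (w \<bullet> \<Sum>F)"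
    by (simp add: power2_norm_eq_inner inner_add_left inner_add_right inner_commute)
  ultimately show ?case
    using insert.hyps by simp
qed simp

text \<open>For n members u with \<open>w \<bullet> u \<le> - e\<close>, Cauchy-Schwarz sets e n,
  linear in n, against |w| sqrt n. So n is at most (|w| / e)^2, a bound common to all finite
  subsets.\<close>

lemma finite_inner_le_neg:
  fixes U :: "'a::real_inner set"
  assumes "\<And>u. u \<in> U \<Longrightarrow> norm u \<le> 1"
    and "\<And>u v. u \<in> U \<Longrightarrow> v \<in> U \<Longrightarrow> u \<noteq> v \<Longrightarrow> u \<bullet> v \<le> 0"
    and "e > 0"
  shows "finite {u \<in> U. w \<bullet> u \<le> - e}"
proof -
  have "card F \<le> nat \<lceil>(norm w)\<^sup>2 / e\<^sup>2\<rceil>" if F: "F \<subseteq> {u \<in> U. w \<bullet> u \<le> - e}" "finite F" for F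
  proof (cases "card F = 0")
    case False
    let ?n = "real (card F)"
    have "w \<bullet> \<Sum>F \<le> - (e * ?n)"
      unfolding inner_sum_right using sum_bounded_above[of F "\<lambda>u. w \<bullet> u" "- e"] F(1)
      by (auto simp: mult.commute)
    moreover have "\<bar>w \<bullet> \<Sum>F\<bar> \<le> norm w * norm (\<Sum>F)"
      by (rule Cauchy_Schwarz_ineq2)
    ultimately have "e * ?n \<le> norm w * norm (\<Sum>F)"
      by linarith
    then have "(e * ?n)\<^sup>2 \<le> (norm w * norm (\<Sum>F))\<^sup>2"
      using \<open>e > 0\<close> by (intro power_mono) auto
    also have "\<dots> \<le> (norm w)\<^sup>2 * ?n"
      unfolding power_mult_distrib
      using assms(1,2) F by (intro mult_left_mono norm_sum_le_of_nonpos_inner) auto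
    \<comment> \<open>Keeping a factor \<open>?n\<close> on both sides lets it cancel; this is why
      the empty case is split off.\<close>
    finally have "(e\<^sup>2 * ?n) * ?n \<le> (norm w)\<^sup>2 * ?n"
      by (simp add: power2_eq_square mult_ac)
    then have "e\<^sup>2 * ?n \<le> (norm w)\<^sup>2"
      using False by (simp add: mult_le_cancel_right)
    then have "?n \<le> (norm w)\<^sup>2 / e\<^sup>2"
      using \<open>e > 0\<close> by (simp add: pos_le_divide_eq mult.commute)
    then show ?thesis by linarith
  qed simp
  then show ?thesis
    using finite_if_finite_subsets_card_bdd[of "{u \<in> U. w \<bullet> u \<le> - e}"] by blast
qed

text \<open>A negative number lies below some -1/(n+1), so \<open>U\<close> is a countable union of
  finite sets around a fixed \<open>w\<close>. The point \<open>w\<close> is inserted by hand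
  because \<open>w \<bullet> w\<close> is not negative.\<close>

lemma countable_of_neg_inner:
  fixes U :: "'a::real_inner set"
  assumes "\<And>u. u \<in> U \<Longrightarrow> norm u \<le> 1"
    and neg: "\<And>u v. u \<in> U \<Longrightarrow> v \<in> U \<Longrightarrow> u \<noteq> v \<Longrightarrow> u \<bullet> v < 0"
  shows "countable U"
proof (cases "U = {}")
  case False
  then obtain w where w: "w \<in> U" by blast
  have "finite {u \<in> U. w \<bullet> u \<le> - inverse (real (Suc n))}" for n
    using assms by (intro finite_inner_le_neg) (auto intro: less_imp_le)
  then have "countable (insert w (\<Union>n. {u \<in> U. w \<bullet> u \<le> - inverse (real (Suc n))}))"
    by (intro countable_insert countable_UN) (auto intro: countable_finite)
  moreover have "U \<subseteq> insert w (\<Union>n. {u \<in> U. w \<bullet> u \<le> - inverse (real (Suc n))})"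
  proof
    fix u assume u: "u \<in> U"
    show "u \<in> insert w (\<Union>n. {u \<in> U. w \<bullet> u \<le> - inverse (real (Suc n))})"
    proof (cases "u = w")
      case False
      then obtain n where "inverse (real (Suc n)) < - (w \<bullet> u)"
        using reals_Archimedean[of "- (w \<bullet> u)"] neg[OF w u] by auto
      then have "w \<bullet> u \<le> - inverse (real (Suc n))" by linarith
      then show ?thesis using u by blast
    qed simp
  qed
  ultimately show ?thesis by (rule countable_subset[rotated])
qed simp

section \<open>Equivalent norms\<close>

lemma equivalent_normD:
  assumes "equivalent_norm N"
  shows equivalent_norm_zero_iff: "N x = 0 \<longleftrightarrow> x = 0"
    and equivalent_norm_scaleR: "N (c *\<^sub>R x) = \<bar>c\<bar> * N x"
    and equivalent_norm_triangle: "N (x + y) \<le> N x + N y"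
    and equivalent_norm_bounds:
      "\<exists>a>0. \<exists>b>0. \<forall>x. a * norm x \<le> N x \<and> N x \<le> b * norm x"
  using assms by (simp_all only: equivalent_norm_def)

text \<open>By homogeneity a norm is the gauge of its unit ball. This gives uniqueness in the
  theorem.\<close>

lemma equivalent_norm_eqI:
  assumes M: "equivalent_norm M" and N: "equivalent_norm N"
    and eq: "norm_cball M 0 1 = norm_cball N 0 1"
  shows "M = N"
proof -
  \<comment> \<open>One inequality for arbitrary \<open>K\<close> and \<open>L\<close>, so that it
    can be applied in both directions.\<close>
  have le: "K x \<le> L x"
    if K: "equivalent_norm K" and L: "equivalent_norm L"
      and KL: "norm_cball K 0 1 = norm_cball L 0 1" for K L :: "'a \<Rightarrow> real" and x
  proof (cases "x = 0")
    case False
    obtain a where "a > 0" "a * norm x \<le> L x"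
      using equivalent_norm_bounds[OF L] by blast
    moreover have "a * norm x > 0"
      using \<open>a > 0\<close> False by simp
    ultimately have pos: "L x > 0"
      by linarith
    have "inverse (L x) *\<^sub>R x \<in> norm_cball L 0 1"
      using pos by (simp add: norm_cball_def equivalent_norm_scaleR[OF L])
    then have "K (inverse (L x) *\<^sub>R x) \<le> 1"
      using KL by (auto simp: norm_cball_def)
    then have "inverse (L x) * K x \<le> 1"
      using pos by (simp add: equivalent_norm_scaleR[OF K])
    then show ?thesis
      using pos by (simp add: field_simps)
  next
    case True
    then show ?thesis
      using equivalent_norm_zero_iff[OF K, of x] equivalent_norm_zero_iff[OF L, of x] by simp
  qed
  show ?thesis
  proof
    show "M x = N x" for x
      using le[OF M N eq] le[OF N M eq[symmetric]] by (rule antisym)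
  qed
qed

text \<open>The two-sided bounds put a ball of either norm inside each ball of the other with the
  same centre. Tilings for \<open>norm_topology N\<close> thereby become Euclidean ones.\<close>

lemma norm_topology_equivalent_norm:
  assumes "equivalent_norm N"
  shows "norm_topology N = euclidean"
proof -
  obtain a b where ab: "a > 0" "b > 0" "\<And>x. a * norm x \<le> N x" "\<And>x. N x \<le> b * norm x"
    using equivalent_norm_bounds[OF assms] by blast
  interpret Metric_space UNIV "\<lambda>x y. N (x - y)"
  proof
    fix x y z :: 'a
    show "0 \<le> N (x - y)"
      using ab(1) by (intro order_trans[OF _ ab(3)]) simp
    show "N (x - y) = N (y - x)"
      using equivalent_norm_scaleR[OF assms, of "-1" "x - y"] by simp
    show "N (x - y) = 0 \<longleftrightarrow> x = y"
      by (simp add: equivalent_norm_zero_iff[OF assms])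
    show "N (x - z) \<le> N (x - y) + N (y - z)"
      using equivalent_norm_triangle[OF assms, of "x - y" "y - z"] by simp
  qed
  have "(\<exists>r>0. mball x r \<subseteq> U) \<longleftrightarrow> (\<exists>r>0. ball x r \<subseteq> U)" for x U
  proof
    assume "\<exists>r>0. mball x r \<subseteq> U"
    then obtain r where r: "r > 0" "mball x r \<subseteq> U" by blast
    have "ball x (r / b) \<subseteq> mball x r"
    proof
      fix y assume "y \<in> ball x (r / b)"
      then have "b * norm (x - y) < r"
        using ab(2) by (simp add: dist_norm pos_less_divide_eq mult.commute)
      then show "y \<in> mball x r"
        using ab(4)[of "x - y"] by simp
    qed
    then show "\<exists>r>0. ball x r \<subseteq> U"
      using r ab(2) by (intro exI[of _ "r / b"]) auto
  next
    assume "\<exists>r>0. ball x r \<subseteq> U"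
    then obtain r where r: "r > 0" "ball x r \<subseteq> U" by blast
    have "mball x (a * r) \<subseteq> ball x r"
    proof
      fix y assume "y \<in> mball x (a * r)"
      then have "a * norm (x - y) < a * r"
        using ab(3)[of "x - y"] by simp
      then show "y \<in> ball x r"
        using ab(1) by (simp add: dist_norm)
    qed
    then show "\<exists>r>0. mball x r \<subseteq> U"
      using r ab(1) by (intro exI[of _ "a * r"]) auto
  qed
  then show ?thesis
    unfolding norm_topology_def topology_eq openin_mtopology
    by (auto simp: open_contains_ball)
qed

section \<open>Voronoi cells of a subgroup\<close>

locale separated_dense_subgroup =
  fixes D :: "'a::real_inner set"
  assumes subgroup: "add_subgroup D"
    and separated: "plus_separated (sqrt 2) D"
    and dense: "r_dense 1 D"
begin

section \<open>Algebra of \<open>D\<close> and its points near a given point\<close>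

lemma zero_mem: "0 \<in> D" and add_mem: "d \<in> D \<Longrightarrow> h \<in> D \<Longrightarrow> d + h \<in> D"
  and uminus_mem: "d \<in> D \<Longrightarrow> - d \<in> D"
  using subgroup unfolding add_subgroup_def by blast+

lemma diff_mem: "d \<in> D \<Longrightarrow> h \<in> D \<Longrightarrow> d - h \<in> D"
  using add_mem[of d "- h"] uminus_mem by simp

text \<open>Expand |d - h|^2 > 2 with d - h = (d - x) - (h - x). For r = 1 the inner products are
  negative; for r < 1 they stay away from 0 uniformly.\<close>

lemma inner_diff_less:
  assumes "d \<in> D" "h \<in> D" "d \<noteq> h" "norm (d - x) \<le> r" "norm (h - x) \<le> r"
  shows "(d - x) \<bullet> (h - x) < r\<^sup>2 - 1"
proof -
  have "sqrt 2 < norm (d - h)"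
    using separated assms(1-3) unfolding plus_separated_def by blast
  then have "(sqrt 2)\<^sup>2 < (norm (d - h))\<^sup>2"
    by (intro power_strict_mono) auto
  then have "2 < (norm ((d - x) - (h - x)))\<^sup>2" by simp
  also have "\<dots> = (norm (d - x))\<^sup>2 + (norm (h - x))\<^sup>2 - 2 * ((d - x) \<bullet> (h - x))"
    unfolding power2_norm_eq_inner inner_diff_left[of "d - x"] inner_diff_right[of _ "d - x" "h - x"]
    by (simp add: inner_commute)
  finally have "2 < \<dots>" .
  moreover have "(norm (d - x))\<^sup>2 \<le> r\<^sup>2" "(norm (h - x))\<^sup>2 \<le> r\<^sup>2"
    using assms(4,5) by (auto intro!: power_mono)
  ultimately show ?thesis by linarith
qed

text \<open>Both point-countability claims reduce to this count.\<close>

lemma countable_near: "countable {d \<in> D. norm (d - x) \<le> 1}"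
proof -
  have "countable ((\<lambda>d. d - x) ` {d \<in> D. norm (d - x) \<le> 1})"
    by (rule countable_of_neg_inner) (use inner_diff_less[where r = 1] in auto)
  then show ?thesis
    by (rule countable_image_inj_on) (simp add: inj_on_def)
qed

lemma finite_near:
  assumes "0 \<le> r" "r < 1"
  shows "finite {d \<in> D. norm (d - x) \<le> r}"
proof (cases "{d \<in> D. norm (d - x) \<le> r} = {}")
  case False
  then obtain w where w: "w \<in> D" "norm (w - x) \<le> r" by blast
  let ?U = "(\<lambda>d. d - x) ` {d \<in> D. norm (d - x) \<le> r}"
  have r1: "r\<^sup>2 < 1"
    using assms by (simp add: abs_square_less_1)
  have "finite {u \<in> ?U. (w - x) \<bullet> u \<le> - (1 - r\<^sup>2)}"
  proof (rule finite_inner_le_neg)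
    fix u v assume "u \<in> ?U" "v \<in> ?U" "u \<noteq> v"
    then show "u \<bullet> v \<le> 0" using inner_diff_less[where r = r] r1 by fastforce
  qed (use assms r1 in auto)
  \<comment> \<open>The uniform gap 1 - r^2 places all members except \<open>w - x\<close> in a
    single finite set.\<close>
  moreover have "?U \<subseteq> insert (w - x) {u \<in> ?U. (w - x) \<bullet> u \<le> - (1 - r\<^sup>2)}"
    using w inner_diff_less[where r = r] by (fastforce intro: less_imp_le)
  ultimately have "finite ?U"
    by (meson finite_insert finite_subset)
  then show ?thesis
    by (rule finite_imageD) (simp add: inj_on_def)
next
  case True
  then show ?thesis by (simp only: finite.emptyI)
qed

text \<open>If some point of \<open>D\<close> is closer than 1, only finitely many compete and a
  minimum exists. Otherwise all distances are at least 1, and density supplies a point at distance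
  at most 1, which is nearest.\<close>

lemma ex_nearest: "\<exists>d\<in>D. \<forall>h\<in>D. norm (x - d) \<le> norm (x - h)"
proof (cases "\<exists>d\<in>D. norm (x - d) < 1")
  case True
  then obtain d where d: "d \<in> D" "norm (x - d) < 1" by blast
  let ?S = "{h \<in> D. norm (h - x) \<le> norm (x - d)}"
  have "finite ?S" "?S \<noteq> {}"
    using d finite_near[of "norm (x - d)" x] by (auto simp: norm_minus_commute)
  then obtain m where m: "m \<in> ?S" "\<And>h. h \<in> ?S \<Longrightarrow> norm (x - m) \<le> norm (x - h)"
    using ex_min_if_finite[of "(\<lambda>h. norm (x - h)) ` ?S"] by (fastforce simp: not_less)
  have "norm (x - m) \<le> norm (x - h)" if "h \<in> D" for h
  proof (cases "h \<in> ?S")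
    case False
    then show ?thesis using m(1) that by (simp add: norm_minus_commute)
  qed (rule m(2))
  then show ?thesis using m(1) by blast
next
  case False
  then show ?thesis
    using dense unfolding r_dense_def by (meson not_less order_trans)
qed

section \<open>Covering, translation and point-countability\<close>

lemma Union_voronoi_cell: "(\<Union>d\<in>D. voronoi_cell D d) = UNIV"
  using ex_nearest unfolding voronoi_cell_def by blast

text \<open>Density gives a point of \<open>D\<close> within 1 of x, and the centre of a cell
  containing x is at least as close.\<close>

lemma voronoi_cell_subset_cball: "voronoi_cell D d \<subseteq> cball d 1"
proof
  fix x assume x: "x \<in> voronoi_cell D d"
  obtain h where "h \<in> D" "norm (x - h) \<le> 1"
    using dense unfolding r_dense_def by blast
  then have "norm (x - d) \<le> 1"
    using x unfolding voronoi_cell_def by fastforce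
  then show "x \<in> cball d 1"
    by (simp add: dist_norm norm_minus_commute)
qed

text \<open>Translation by \<open>d\<close> permutes the subgroup \<open>D\<close>, so it permutes
  the competing centres.\<close>

lemma mem_voronoi_cell_iff:
  assumes "d \<in> D"
  shows "x \<in> voronoi_cell D d \<longleftrightarrow> x - d \<in> voronoi_cell D 0"
proof
  assume x: "x \<in> voronoi_cell D d"
  have "norm (x - d) \<le> norm (x - d - h)" if "h \<in> D" for h
    using x add_mem[OF assms that] unfolding voronoi_cell_def by (simp add: diff_diff_eq)
  then show "x - d \<in> voronoi_cell D 0" by (simp add: voronoi_cell_def)
next
  assume x: "x - d \<in> voronoi_cell D 0"
  have "norm (x - d) \<le> norm (x - h)" if "h \<in> D" for h
    using x diff_mem[OF that assms] unfolding voronoi_cell_def by fastforce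
  then show "x \<in> voronoi_cell D d" by (simp add: voronoi_cell_def)
qed

lemma voronoi_cell_eq_translate:
  assumes "d \<in> D"
  shows "voronoi_cell D d = (+) d ` voronoi_cell D 0"
proof (intro set_eqI iffI)
  fix x assume "x \<in> voronoi_cell D d"
  then show "x \<in> (+) d ` voronoi_cell D 0"
    using mem_voronoi_cell_iff[OF assms] by (intro image_eqI[of _ _ "x - d"]) auto
qed (auto simp: mem_voronoi_cell_iff[OF assms])

lemma point_countable_cball: "point_countable D (\<lambda>d. (+) d ` cball 0 1)"
  using countable_near unfolding point_countable_def image_add_cball add_0_left mem_cball dist_norm by blast

lemma point_countable_voronoi_cell: "point_countable D (voronoi_cell D)"
  unfolding point_countable_def
proof
  fix x
  have "{d \<in> D. x \<in> voronoi_cell D d} \<subseteq> {d \<in> D. norm (d - x) \<le> 1}"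
    using voronoi_cell_subset_cball unfolding subset_iff mem_cball dist_norm by blast
  then show "countable {d \<in> D. x \<in> voronoi_cell D d}"
    using countable_near by (rule countable_subset)
qed

lemma Union_cball: "(\<Union>d\<in>D. (+) d ` cball 0 1) = UNIV"
proof -
  have "UNIV \<subseteq> (\<Union>d\<in>D. cball d 1)"
    unfolding Union_voronoi_cell[symmetric] by (intro UN_mono subset_refl voronoi_cell_subset_cball)
  then show ?thesis
    unfolding image_add_cball add_0_left by (rule top.extremum_uniqueI)
qed

section \<open>The gauge of the cell at 0\<close>

text \<open>The term for \<open>h = 0\<close> is \<open>0 / 0 = 0\<close>, which does not affect the supremum.\<close>

definition voronoi_norm :: "'a \<Rightarrow> real" where
  "voronoi_norm x = (SUP h\<in>D. 2 * (x \<bullet> h) / (norm h)\<^sup>2)"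

text \<open>Separation from 0 gives |h| > sqrt 2 for nonzero h. The bound makes the supremum finite
  and yields the upper constant of the norm equivalence.\<close>

lemma voronoi_term_le:
  assumes "h \<in> D"
  shows "2 * (x \<bullet> h) / (norm h)\<^sup>2 \<le> sqrt 2 * norm x"
proof (cases "h = 0")
  case False
  have "sqrt 2 < norm (h - 0)"
    using separated assms zero_mem False unfolding plus_separated_def by blast
  then have h: "sqrt 2 < norm h" by simp
  have "2 * (x \<bullet> h) \<le> 2 * (norm x * norm h)"
    using norm_cauchy_schwarz[of x h] by simp
  \<comment> \<open>Splitting 2 as sqrt 2 * sqrt 2 leaves one factor to be absorbed by |h|.\<close>
  also have "\<dots> = sqrt 2 * norm x * (sqrt 2 * norm h)"
    by simp
  also have "\<dots> \<le> sqrt 2 * norm x * (norm h * norm h)"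
    using h by (intro mult_left_mono mult_right_mono) auto
  finally show ?thesis
    using False by (simp add: pos_divide_le_eq power2_eq_square)
qed simp

lemma bdd_above_voronoi_term: "bdd_above ((\<lambda>h. 2 * (x \<bullet> h) / (norm h)\<^sup>2) ` D)"
  using voronoi_term_le by (intro bdd_aboveI2)

lemma voronoi_norm_upper: "h \<in> D \<Longrightarrow> 2 * (x \<bullet> h) / (norm h)\<^sup>2 \<le> voronoi_norm x"
  unfolding voronoi_norm_def by (rule cSUP_upper[OF _ bdd_above_voronoi_term])

lemma voronoi_norm_least:
  "(\<And>h. h \<in> D \<Longrightarrow> 2 * (x \<bullet> h) / (norm h)\<^sup>2 \<le> c) \<Longrightarrow> voronoi_norm x \<le> c"
  unfolding voronoi_norm_def using zero_mem by (intro cSUP_least) blast+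

text \<open>The term for \<open>h = 0\<close> has value 0.\<close>

lemma voronoi_norm_nonneg: "0 \<le> voronoi_norm x"
  using voronoi_norm_upper[OF zero_mem] by simp

text \<open>Squaring turns each comparison of distances into the half-space
  \<open>2 * (x \<bullet> h) \<le> (norm h)\<^sup>2\<close>; the functionals are scaled so that its
  boundary is at level 1.\<close>

lemma voronoi_norm_le_one_iff: "voronoi_norm x \<le> 1 \<longleftrightarrow> x \<in> voronoi_cell D 0"
proof -
  have "2 * (x \<bullet> h) / (norm h)\<^sup>2 \<le> 1 \<longleftrightarrow> norm x \<le> norm (x - h)" for h
  proof -
    have "norm x \<le> norm (x - h) \<longleftrightarrow> (norm x)\<^sup>2 \<le> (norm (x - h))\<^sup>2"
      by simp
    also have "\<dots> \<longleftrightarrow> 2 * (x \<bullet> h) \<le> (norm h)\<^sup>2"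
      by (auto simp: power2_norm_eq_inner inner_diff_left inner_diff_right inner_commute)
    also have "\<dots> \<longleftrightarrow> 2 * (x \<bullet> h) / (norm h)\<^sup>2 \<le> 1"
      \<comment> \<open>For \<open>h = 0\<close> both sides hold, since 0 / 0 = 0.\<close>
      by (cases "h = 0") (auto simp: pos_divide_le_eq)
    finally show ?thesis by simp
  qed
  moreover have "voronoi_norm x \<le> 1 \<longleftrightarrow> (\<forall>h\<in>D. 2 * (x \<bullet> h) / (norm h)\<^sup>2 \<le> 1)"
    using voronoi_norm_least voronoi_norm_upper by (meson order_trans)
  ultimately show ?thesis by (simp add: voronoi_cell_def)
qed

lemma voronoi_norm_scale_le:
  assumes "c \<ge> 0"
  shows "voronoi_norm (c *\<^sub>R x) \<le> c * voronoi_norm x"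
proof (rule voronoi_norm_least)
  fix h assume "h \<in> D"
  from mult_left_mono[OF voronoi_norm_upper[OF this, of x] assms]
  show "2 * (c *\<^sub>R x \<bullet> h) / (norm h)\<^sup>2 \<le> c * voronoi_norm x"
    by (simp add: mult_ac)
qed

lemma voronoi_norm_minus_le: "voronoi_norm (- x) \<le> voronoi_norm x"
proof (rule voronoi_norm_least)
  fix h assume "h \<in> D"
  from voronoi_norm_upper[OF uminus_mem[OF this], of x]
  show "2 * (- x \<bullet> h) / (norm h)\<^sup>2 \<le> voronoi_norm x" by simp
qed

lemma voronoi_norm_minus: "voronoi_norm (- x) = voronoi_norm x"
  using voronoi_norm_minus_le[of x] voronoi_norm_minus_le[of "- x"] by simp

lemma voronoi_norm_scale_nonneg:
  assumes "c \<ge> 0"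
  shows "voronoi_norm (c *\<^sub>R x) = c * voronoi_norm x"
proof (cases "c = 0")
  case False
  then have c: "c > 0" using assms by simp
  have "voronoi_norm x \<le> inverse c * voronoi_norm (c *\<^sub>R x)"
    \<comment> \<open>The reverse inequality comes from scaling back by the inverse.\<close>
    using voronoi_norm_scale_le[of "inverse c" "c *\<^sub>R x"] c by simp
  then have "c * voronoi_norm x \<le> voronoi_norm (c *\<^sub>R x)"
    using c by (simp add: field_simps)
  then show ?thesis
    using voronoi_norm_scale_le[OF assms, of x] by simp
next
  case True
  then show ?thesis
    using voronoi_norm_scale_le[of 0 x] voronoi_norm_nonneg[of 0] by simp
qed

lemma voronoi_norm_scale: "voronoi_norm (c *\<^sub>R x) = \<bar>c\<bar> * voronoi_norm x"
proof (cases "c \<ge> 0")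
  case False
  then have "voronoi_norm (- ((- c) *\<^sub>R x)) = (- c) * voronoi_norm x"
    unfolding voronoi_norm_minus by (intro voronoi_norm_scale_nonneg) simp
  then show ?thesis using False by simp
qed (simp add: voronoi_norm_scale_nonneg)

lemma voronoi_norm_triangle: "voronoi_norm (x + y) \<le> voronoi_norm x + voronoi_norm y"
proof (rule voronoi_norm_least)
  fix h assume "h \<in> D"
  from add_mono[OF voronoi_norm_upper[OF this, of x] voronoi_norm_upper[OF this, of y]]
  show "2 * ((x + y) \<bullet> h) / (norm h)\<^sup>2 \<le> voronoi_norm x + voronoi_norm y"
    by (simp add: inner_add_left distrib_left add_divide_distrib)
qed

lemma voronoi_norm_le: "voronoi_norm x \<le> sqrt 2 * norm x"
  by (rule voronoi_norm_least) (rule voronoi_term_le)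

text \<open>For c above the gauge of x, x / c lies in the cell at 0, hence in the unit ball. Taking
  c strictly larger avoids dividing by a gauge not yet known to be positive.\<close>

lemma norm_le_voronoi_norm: "norm x \<le> voronoi_norm x"
proof (rule dense_ge)
  fix c assume c: "voronoi_norm x < c"
  then have "c > 0" using voronoi_norm_nonneg[of x] by linarith
  then have "voronoi_norm (inverse c *\<^sub>R x) \<le> 1"
    using c by (simp add: voronoi_norm_scale field_simps)
  then have "norm (inverse c *\<^sub>R x) \<le> 1"
    using voronoi_norm_le_one_iff voronoi_cell_subset_cball[of 0] by auto
  then show "norm x \<le> c"
    using \<open>c > 0\<close> by (simp add: field_simps)
qed

lemma equivalent_norm_voronoi_norm: "equivalent_norm voronoi_norm"
proof -
  have "voronoi_norm x = 0 \<longleftrightarrow> x = 0" for x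
    using norm_le_voronoi_norm[of x] voronoi_norm_scale[of 0 x] by auto
  moreover have "\<exists>a>0. \<exists>b>0. \<forall>x. a * norm x \<le> voronoi_norm x \<and> voronoi_norm x \<le> b * norm x"
    by (rule exI[of _ 1], simp, rule exI[of _ "sqrt 2"])
      (simp add: norm_le_voronoi_norm voronoi_norm_le)
  ultimately show ?thesis
    unfolding equivalent_norm_def
    by (intro conjI allI voronoi_norm_scale voronoi_norm_triangle)
qed

lemma norm_cball_voronoi_norm:
  assumes "d \<in> D"
  shows "norm_cball voronoi_norm d 1 = voronoi_cell D d"
  using mem_voronoi_cell_iff[OF assms] by (auto simp: norm_cball_def voronoi_norm_le_one_iff)

section \<open>Topology of the cells and the lattice tiling\<close>

lemma closed_voronoi_cell: "closed (voronoi_cell D d)"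
proof -
  have "voronoi_cell D d = (\<Inter>h\<in>D. {x. norm (x - d) \<le> norm (x - h)})"
    by (auto simp: voronoi_cell_def)
  then show ?thesis
    by (auto intro!: closed_INT closed_Collect_le continuous_intros)
qed

lemma voronoi_norm_less_one_interior:
  assumes "d \<in> D" "voronoi_norm (x - d) < 1"
  shows "x \<in> interior (voronoi_cell D d)"
proof -
  \<comment> \<open>The slack below 1, divided by the constant sqrt 2 from
    \<open>voronoi_norm_le\<close>.\<close>
  let ?r = "(1 - voronoi_norm (x - d)) / sqrt 2"
  have "ball x ?r \<subseteq> voronoi_cell D d"
  proof
    fix y assume "y \<in> ball x ?r"
    then have "sqrt 2 * norm (y - x) < 1 - voronoi_norm (x - d)"
      by (simp add: dist_norm norm_minus_commute pos_less_divide_eq mult.commute)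
    then have "voronoi_norm ((x - d) + (y - x)) \<le> 1"
      using voronoi_norm_triangle[of "x - d" "y - x"] voronoi_norm_le[of "y - x"] by linarith
    then show "y \<in> voronoi_cell D d"
      using mem_voronoi_cell_iff[OF assms(1)] voronoi_norm_le_one_iff by simp
  qed
  moreover have "?r > 0" using assms(2) by simp
  ultimately show ?thesis
    by (auto simp: mem_interior)
qed

lemma is_body_voronoi_cell:
  assumes d: "d \<in> D"
  shows "is_body euclidean (voronoi_cell D d)"
proof -
  let ?V = "voronoi_cell D d"
  have "d \<in> interior ?V"
    using voronoi_norm_less_one_interior[OF d, of d] voronoi_norm_scale[of 0 0] by simp
  moreover have "?V \<subseteq> closure (interior ?V)"
  proof
    fix x assume x: "x \<in> ?V"
    \<comment> \<open>Points on the segment from \<open>d\<close> to \<open>x\<close>: shrinking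
      towards \<open>d\<close> makes the gauge less than 1, and the factors tend to 1.\<close>
    define f where "f n = d + (1 - inverse (real (Suc n))) *\<^sub>R (x - d)" for n
    have "f n \<in> interior ?V" for n
    proof (rule voronoi_norm_less_one_interior[OF d])
      have t: "0 \<le> 1 - inverse (real (Suc n))" "1 - inverse (real (Suc n)) < 1"
        by (simp_all add: field_simps)
      have "voronoi_norm (f n - d) = (1 - inverse (real (Suc n))) * voronoi_norm (x - d)"
        using t(1) by (simp add: f_def voronoi_norm_scale_nonneg)
      also have "\<dots> \<le> 1 - inverse (real (Suc n))"
        using x mem_voronoi_cell_iff[OF d] voronoi_norm_le_one_iff t(1)
        by (intro mult_left_le) auto
      finally show "voronoi_norm (f n - d) < 1" using t(2) by linarith
    qed
    moreover have "f \<longlonglongrightarrow> d + (1 - 0) *\<^sub>R (x - d)"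
      unfolding f_def by (intro tendsto_intros LIMSEQ_inverse_real_of_nat)
    ultimately show "x \<in> closure (interior ?V)"
      unfolding closure_sequential by auto
  qed
  moreover have "closure (interior ?V) \<subseteq> ?V"
    using closed_voronoi_cell interior_subset by (metis closure_minimal)
  ultimately show ?thesis
    unfolding is_body_def by auto
qed

text \<open>Points of a common ball are equidistant from \<open>d\<close> and \<open>h\<close>, but
  moving from x in the direction \<open>h - d\<close> changes the two squared distances by different
  amounts.\<close>

lemma disjoint_interior_voronoi_cell:
  assumes "d \<in> D" "h \<in> D" "d \<noteq> h"
  shows "interior (voronoi_cell D d) \<inter> interior (voronoi_cell D h) = {}"
proof (rule ccontr)
  assume "interior (voronoi_cell D d) \<inter> interior (voronoi_cell D h) \<noteq> {}"
  then obtain x where x: "x \<in> interior (voronoi_cell D d \<inter> voronoi_cell D h)"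
    by (auto simp: interior_Int)
  then obtain e where e: "e > 0" "ball x e \<subseteq> voronoi_cell D d \<inter> voronoi_cell D h"
    unfolding mem_interior by blast
  have eq: "(norm (y - d))\<^sup>2 = (norm (y - h))\<^sup>2" if "y \<in> ball x e" for y
  proof -
    have "norm (y - d) \<le> norm (y - h)" "norm (y - h) \<le> norm (y - d)"
      using that e(2) assms(1,2) unfolding voronoi_cell_def by blast+
    then show ?thesis by simp
  qed
  \<comment> \<open>The displacement then has length e / 2 and stays in the ball.\<close>
  define t where "t = e / (2 * norm (h - d))"
  have t: "t > 0" "t * norm (h - d) < e"
    using e(1) assms(3) by (simp_all add: t_def)
  let ?y = "x + t *\<^sub>R (h - d)"
  have "(norm (?y - k))\<^sup>2 = (norm (x - k))\<^sup>2 + 2 * t * ((x - k) \<bullet> (h - d)) + (norm (t *\<^sub>R (h - d)))\<^sup>2" for k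
    using dot_norm[of "x - k" "t *\<^sub>R (h - d)"] by (simp add: add_diff_eq diff_add_eq)
  from this[of d] this[of h]
  moreover have "(norm (?y - d))\<^sup>2 = (norm (?y - h))\<^sup>2"
    using t by (intro eq) (simp add: dist_norm)
  moreover have "(norm (x - d))\<^sup>2 = (norm (x - h))\<^sup>2"
    using e(1) by (intro eq) simp
  ultimately have "(x - d) \<bullet> (h - d) = (x - h) \<bullet> (h - d)"
    using t(1) by simp
  then have "(h - d) \<bullet> (h - d) = 0"
    by (simp add: inner_diff_left)
  then show False using assms(3) by simp
qed

lemma is_tiling_voronoi_cell: "is_tiling euclidean D (voronoi_cell D)"
  unfolding is_tiling_def
  by (intro conjI ballI impI)
    (simp_all add: is_body_voronoi_cell Union_voronoi_cell disjoint_interior_voronoi_cell)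

text \<open>By separation, the ball of radius sqrt 2 about a point of \<open>D\<close> contains no
  other point of \<open>D\<close>.\<close>

lemma subtopology_discrete: "subtopology euclidean D = discrete_topology D"
proof -
  have "openin (subtopology euclidean D) {d}" if "d \<in> D" for d
  proof -
    have "D \<inter> ball d (sqrt 2) = {d}"
      using separated that unfolding plus_separated_def by (fastforce simp: dist_norm)
    then show ?thesis
      by (metis open_ball openin_open_Int)
  qed
  then have "discrete_topology D = subtopology euclidean D"
    by (simp add: discrete_topology_unique)
  then show ?thesis by (rule sym)
qed

lemma is_lattice_tiling_voronoi_cell: "is_lattice_tiling euclidean D (voronoi_cell D)"
  unfolding is_lattice_tiling_def
proof
  have "voronoi_cell D ` D = (\<lambda>d. (+) d ` voronoi_cell D 0) ` D"
    using voronoi_cell_eq_translate by (rule image_cong[OF refl])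
  then show "\<exists>B E. is_body euclidean B \<and> add_subgroup E \<and>
      subtopology euclidean E = discrete_topology E \<and> voronoi_cell D ` D = (\<lambda>d. (+) d ` B) ` E"
    \<comment> \<open>The witnesses are the cell at 0 and \<open>D\<close> itself.\<close>
    using is_body_voronoi_cell[OF zero_mem] subgroup subtopology_discrete
    by (intro exI conjI)
qed (rule is_tiling_voronoi_cell)

end

theorem proposition3p5:
  fixes D :: "'g ell2 set"
  assumes "infinite (UNIV :: 'g set)"
    and "|UNIV :: 'g set| ^c natLeq =o |UNIV :: 'g set|"
    and "add_subgroup D"
    and "plus_separated (sqrt 2) D"
    and "r_dense 1 D"
  shows "is_tiling euclidean D (voronoi_cell D) \<and> point_countable D (voronoi_cell D) \<and>
    (\<exists>!N. equivalent_norm N \<and> norm_cball N 0 1 = voronoi_cell D 0) \<and>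
    (\<forall>N. equivalent_norm N \<and> norm_cball N 0 1 = voronoi_cell D 0 \<longrightarrow>
       (\<exists>(I :: 'g ell2 set) F.
          is_lattice_tiling (norm_topology N) I F \<and> point_countable I F \<and>
          (\<forall>i\<in>I. \<exists>c. F i = norm_cball N c 1))) \<and>
    (\<Union>d\<in>D. (+) d ` cball 0 1) = UNIV \<and> point_countable D (\<lambda>d. (+) d ` cball 0 1)"
proof -
  interpret separated_dense_subgroup D
    using assms(3-5) by unfold_locales
  have N: "equivalent_norm voronoi_norm \<and> norm_cball voronoi_norm 0 1 = voronoi_cell D 0"
    using equivalent_norm_voronoi_norm norm_cball_voronoi_norm[OF zero_mem] by (rule conjI)
  \<comment> \<open>Every norm with this unit ball is \<open>voronoi_norm\<close>, so the claim
    about all such \<open>N\<close> concerns one norm only.\<close>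
  have unique: "N = voronoi_norm" if "equivalent_norm N \<and> norm_cball N 0 1 = voronoi_cell D 0" for N
    by (rule equivalent_norm_eqI) (simp_all only: that N)
  have "\<exists>c. voronoi_cell D d = norm_cball voronoi_norm c 1" if "d \<in> D" for d
    using norm_cball_voronoi_norm[OF that] by (metis (no_types))
  then have tiling: "\<exists>(I :: 'g ell2 set) F. is_lattice_tiling (norm_topology N) I F \<and>
      point_countable I F \<and> (\<forall>i\<in>I. \<exists>c. F i = norm_cball N c 1)"
    if "equivalent_norm N \<and> norm_cball N 0 1 = voronoi_cell D 0" for N
    \<comment> \<open>The topology becomes the Euclidean one, where the cells, now unit balls of the
      norm, form the required lattice tiling.\<close>
    unfolding unique[OF that] norm_topology_equivalent_norm[OF equivalent_norm_voronoi_norm]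
    using is_lattice_tiling_voronoi_cell point_countable_voronoi_cell
    by (intro exI[of _ D] exI[of _ "voronoi_cell D"] conjI ballI)
  have "\<exists>!N. equivalent_norm N \<and> norm_cball N 0 1 = voronoi_cell D 0"
    by (rule ex1I[of _ voronoi_norm]) (rule N, rule unique)
  then show ?thesis
    using is_tiling_voronoi_cell point_countable_voronoi_cell tiling
      Union_cball point_countable_cball
    by (intro conjI allI impI)
qed

end
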